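(* Let $m\geq 1$ and let $K_{m,2}$ be the complete bipartite graph with parts $\{v_0,v_1,\ldots,v_{m-1}\}$ and $\{v_m,v_{m+1}\}$, with sink $v_0$. Its lacking polynomial is $$L_{m,2}(x)=\sum_{k=0}^{m-1}S(m-1,k)x^k,\qquad\text{where } S(m-1,k)=\sum_{q=0}^{k}\sum_{r=0}^{q}\binom{m-1}{r}\ \text{ for } 0\leq k\leq m-1.$$
   Context: Let $G$ be a finite connected loop-free graph with a distinguished sink vertex $s$. A configuration assigns a non-negative integer $c(v)$ to each non-sink vertex $v$; it is stable if $c(v)<d(v)$ for every non-sink $v$, where $d(v)$ is the degree. For an orientation $\mathcal{O}$ of $G$, $\mathrm{in}_{\mathcal{O}}(v)$ is the number of edges directed into $v$; $c$ is compatible with $\mathcal{O}$ if $\mathrm{in}_{\mathcal{O}}(v)\geq d(v)-c(v)$ for every non-sink $v$. The set $\mathsf{Sto}(G)$ of stochastically recurrent states is the set of stable configurations compatible with at least one orientation of $G$. The lacking polynomial is $L_G(x)=\sum_{c\in\mathsf{Sto}(G)}x^{\ell(c)}$, where $\ell(c)=\sum_{v\neq s}(d(v)-c(v)-1)$. $L_{m,2}$ denotes $L_{K_{m,2}}$ with sink $v_0$. *)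

theory Defs
  imports "HOL-Library.FuncSet" "HOL-Computational_Algebra.Polynomial"
begin

text \<open>
  Graphs may have multiple edges: an edge is an abstract object and \<open>ends\<close> gives its set of
  endpoints. Loop-freeness is the requirement that this set has exactly two elements.
\<close>

record ('v, 'e) graph =
  verts :: "'v set"
  edges :: "'e set"
  ends :: "'e \<Rightarrow> 'v set"

definition adj :: "('v, 'e) graph \<Rightarrow> ('v \<times> 'v) set" where
  "adj G = {(u, v). \<exists>e\<in>edges G. ends G e = {u, v}}"

definition connected_graph :: "('v, 'e) graph \<Rightarrow> bool" where
  "connected_graph G \<longleftrightarrow> (\<forall>u\<in>verts G. \<forall>v\<in>verts G. (u, v) \<in> (adj G)\<^sup>*)"

definition sandpile_graph :: "('v, 'e) graph \<Rightarrow> 'v \<Rightarrow> bool" where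
  "sandpile_graph G s \<longleftrightarrow>
     finite (verts G) \<and> finite (edges G) \<and>
     (\<forall>e\<in>edges G. ends G e \<subseteq> verts G \<and> card (ends G e) = 2) \<and>
     connected_graph G \<and> s \<in> verts G"

definition vdegree :: "('v, 'e) graph \<Rightarrow> 'v \<Rightarrow> nat" where
  "vdegree G v = card {e \<in> edges G. v \<in> ends G e}"

text \<open>
  Configurations are extensional functions on the non-sink vertices, so that functions differing
  only at the sink or outside the graph are not counted twice.
\<close>

definition configurations :: "('v, 'e) graph \<Rightarrow> 'v \<Rightarrow> ('v \<Rightarrow> nat) set" where
  "configurations G s = (verts G - {s}) \<rightarrow>\<^sub>E UNIV"

definition stable :: "('v, 'e) graph \<Rightarrow> 'v \<Rightarrow> ('v \<Rightarrow> nat) \<Rightarrow> bool" where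
  "stable G s c \<longleftrightarrow> (\<forall>v\<in>verts G - {s}. c v < vdegree G v)"

text \<open>
  Since there are no loops, an orientation is determined by the head of each edge.
\<close>

definition orientation :: "('v, 'e) graph \<Rightarrow> ('e \<Rightarrow> 'v) \<Rightarrow> bool" where
  "orientation G h \<longleftrightarrow> (\<forall>e\<in>edges G. h e \<in> ends G e)"

definition indegree :: "('v, 'e) graph \<Rightarrow> ('e \<Rightarrow> 'v) \<Rightarrow> 'v \<Rightarrow> nat" where
  "indegree G h v = card {e \<in> edges G. h e = v}"

definition compatible :: "('v, 'e) graph \<Rightarrow> 'v \<Rightarrow> ('e \<Rightarrow> 'v) \<Rightarrow> ('v \<Rightarrow> nat) \<Rightarrow> bool" where
  "compatible G s h c \<longleftrightarrow>
     (\<forall>v\<in>verts G - {s}. int (indegree G h v) \<ge> int (vdegree G v) - int (c v))"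

definition Sto :: "('v, 'e) graph \<Rightarrow> 'v \<Rightarrow> ('v \<Rightarrow> nat) set" where
  "Sto G s = {c \<in> configurations G s. stable G s c \<and> (\<exists>h. orientation G h \<and> compatible G s h c)}"

text \<open>
  The natural-number subtraction below is exact on stable configurations.
\<close>

definition lacking :: "('v, 'e) graph \<Rightarrow> 'v \<Rightarrow> ('v \<Rightarrow> nat) \<Rightarrow> nat" where
  "lacking G s c = (\<Sum>v\<in>verts G - {s}. vdegree G v - c v - 1)"

definition lacking_poly :: "('v, 'e) graph \<Rightarrow> 'v \<Rightarrow> int poly" where
  "lacking_poly G s = (\<Sum>c\<in>Sto G s. monom 1 (lacking G s c))"

text \<open>
  The vertex \<open>v\<^sub>i\<close> is the number \<open>i\<close>; the parts are \<open>{0..<m}\<close> and \<open>{m..<m + n}\<close>.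
\<close>

definition complete_bipartite :: "nat \<Rightarrow> nat \<Rightarrow> (nat, nat \<times> nat) graph" where
  "complete_bipartite m n =
     \<lparr>verts = {0..<m + n}, edges = {0..<m} \<times> {m..<m + n}, ends = (\<lambda>(i, j). {i, j})\<rparr>"

lemma finite_Sto:
  assumes "finite (verts G)"
  shows "finite (Sto G s)"
proof (rule finite_subset)
  show "Sto G s \<subseteq> (\<Pi>\<^sub>E v\<in>verts G - {s}. {..<vdegree G v})"
    by (auto simp: Sto_def configurations_def stable_def PiE_def)
  show "finite (\<Pi>\<^sub>E v\<in>verts G - {s}. {..<vdegree G v})"
    using assms by (intro finite_PiE) auto
qed

lemma sandpile_graph_complete_bipartite:
  assumes "m \<ge> 1" and "n \<ge> 1"
  shows "sandpile_graph (complete_bipartite m n) 0"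
proof -
  let ?G = "complete_bipartite m n"
  have a: "(i, j) \<in> adj ?G \<and> (j, i) \<in> adj ?G" if "i < m" "m \<le> j" "j < m + n" for i j
  proof -
    have "(i, j) \<in> edges ?G" "ends ?G (i, j) = {i, j}"
      using that by (auto simp: complete_bipartite_def)
    then have "\<exists>e\<in>edges ?G. ends ?G e = {i, j}"
      by (rule bexI[rotated])
    moreover have "{j, i} = {i, j}"
      by (rule insert_commute)
    ultimately show ?thesis
      unfolding adj_def mem_Collect_eq prod.case by simp
  qed
  have to0: "(u, 0) \<in> (adj ?G)\<^sup>* \<and> (0, u) \<in> (adj ?G)\<^sup>*" if "u < m + n" for u
  proof (cases "u < m")
    case True
    have "(u, m) \<in> adj ?G" "(m, u) \<in> adj ?G" "(0, m) \<in> adj ?G" "(m, 0) \<in> adj ?G"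
      using a[of u m] a[of 0 m] True assms by simp_all
    then show ?thesis
      using rtrancl_into_rtrancl[OF r_into_rtrancl, of u m "adj ?G" 0]
        rtrancl_into_rtrancl[OF r_into_rtrancl, of 0 m "adj ?G" u] by simp
  next
    case False
    then have "(u, 0) \<in> adj ?G" "(0, u) \<in> adj ?G"
      using a[of 0 u] that assms by simp_all
    then show ?thesis
      by (simp add: r_into_rtrancl)
  qed
  have "connected_graph ?G"
    unfolding connected_graph_def
  proof (intro ballI)
    fix u v assume "u \<in> verts ?G" "v \<in> verts ?G"
    then have "u < m + n" "v < m + n"
      by (auto simp: complete_bipartite_def)
    then show "(u, v) \<in> (adj ?G)\<^sup>*"
      using rtrancl_trans[of u 0 "adj ?G" v] to0 by simp
  qed
  then show ?thesis
    using assms by (auto simp: sandpile_graph_def complete_bipartite_def)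
qed

end

theory Submission
  imports Defs
begin

text \<open>
  Counting the edges by their heads shows that a stable configuration compatible with an
  orientation lacks at most \<open>|E| - |V| + 1\<close> grains; for \<open>K\<^bsub>m,2\<^esub>\<close> this bound is \<open>m - 1\<close>, and it
  is also sufficient. Indeed, direct both edges of the sink away from it, both edges of each empty
  vertex of degree two towards it, and use each other vertex of degree two to supply one of
  \<open>v\<^sub>m\<close>, \<open>v\<^bsub>m+1\<^esub>\<close>. A configuration lacking \<open>k \<le> m - 1\<close> grains, with \<open>A\<close> the set of empty
  vertices of degree two, is encoded by \<open>A\<close> and the number \<open>q\<close> with \<open>|A| \<le> q \<le> k\<close> of grains
  lacking outside \<open>v\<^bsub>m+1\<^esub>\<close>; counting such pairs gives \<open>S(m - 1, k)\<close>.
\<close>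

text \<open>Stability makes the truncated subtraction exact, so each summand of
  \<open>lacking\<close> plus one is \<open>vdegree G v - c v\<close>, which compatibility bounds by
  the in-degree. Distinct heads give disjoint sets of edges.\<close>

lemma lacking_le_if_compatible:
  assumes fin: "finite (verts G)" "finite (edges G)" and s: "s \<in> verts G"
    and comp: "compatible G s h c" and stab: "stable G s c"
  shows "lacking G s c + card (verts G) \<le> card (edges G) + 1"
proof -
  let ?W = "verts G - {s}"
  have "lacking G s c + card ?W = (\<Sum>v\<in>?W. (vdegree G v - c v - 1) + 1)"
    by (simp only: lacking_def sum.distrib) simp
  also have "\<dots> \<le> (\<Sum>v\<in>?W. indegree G h v)"
    using comp stab by (intro sum_mono) (force simp: compatible_def stable_def)
  also have "\<dots> = card (\<Union>v\<in>?W. {e \<in> edges G. h e = v})"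
    unfolding indegree_def using fin by (intro card_UN_disjoint[symmetric]) auto
  also have "\<dots> \<le> card (edges G)"
    using fin by (intro card_mono) auto
  finally show ?thesis
    using fin s by (simp add: card_Diff_singleton card_gt_0_iff)
qed

lemma vdegree_complete_bipartite:
  "vdegree (complete_bipartite m n) v = (if v < m then n else if v < m + n then m else 0)"
proof -
  let ?E = "{e \<in> edges (complete_bipartite m n). v \<in> ends (complete_bipartite m n) e}"
  have "?E = (if v < m then {v} \<times> {m..<m + n} else if v < m + n then {0..<m} \<times> {v} else {})"
    by (auto simp: complete_bipartite_def)
  then show ?thesis
    by (simp add: vdegree_def)
qed

lemma nonsink_verts_complete_bipartite_2:
  assumes "m \<ge> 1"
  shows "verts (complete_bipartite m 2) - {0} = {1..<m} \<union> {m, m + 1}"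
  using assms by (auto simp: complete_bipartite_def)

text \<open>A stable configuration takes only the values 0 and 1 on \<open>{1..<m}\<close>, so such
  a vertex lacks one grain exactly when it is empty.\<close>

lemma lacking_complete_bipartite_2:
  assumes m: "m \<ge> 1" and stab: "stable (complete_bipartite m 2) 0 c"
  shows "lacking (complete_bipartite m 2) 0 c =
    card {i \<in> {1..<m}. c i = 0} + (m - 1 - c m) + (m - 1 - c (m + 1))"
proof -
  have "c i < 2" if "i \<in> {1..<m}" for i
    using stab that m unfolding stable_def nonsink_verts_complete_bipartite_2[OF m]
    by (force simp: vdegree_complete_bipartite)
  then have "(\<Sum>i\<in>{1..<m}. 2 - c i - 1) = (\<Sum>i\<in>{1..<m}. if c i = 0 then 1 else 0)"
    by (intro sum.cong) (auto simp: less_2_cases_iff)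
  also have "\<dots> = card {i \<in> {1..<m}. c i = 0}"
    by (simp add: sum.If_cases Int_def)
  finally show ?thesis
    unfolding lacking_def nonsink_verts_complete_bipartite_2[OF m]
    by (subst sum.union_disjoint) (auto simp: vdegree_complete_bipartite)
qed

lemma ex_compatible_complete_bipartite_2:
  assumes m: "m \<ge> 1" and stab: "stable (complete_bipartite m 2) 0 c"
    and le: "lacking (complete_bipartite m 2) 0 c \<le> m - 1"
  shows "\<exists>h. orientation (complete_bipartite m 2) h \<and> compatible (complete_bipartite m 2) 0 h c"
proof -
  let ?G = "complete_bipartite m 2"
  define A where "A = {i \<in> {1..<m}. c i = 0}"
  define B where "B = {1..<m} - A"
  have "card B = m - 1 - card A"
    unfolding B_def by (subst card_Diff_subset) (auto simp: A_def)
  \<comment> \<open>With \<open>card A\<close> cancelled, the bound says that \<open>B\<close> is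
    large enough to serve \<open>m\<close> and \<open>m + 1\<close> by disjoint subsets,
    \<open>P\<close> and \<open>B - P\<close>.\<close>
  then have le': "(m - 1 - c m) + (m - 1 - c (m + 1)) \<le> card B"
    using le lacking_complete_bipartite_2[OF m stab] by (simp add: A_def)
  then obtain P where P: "P \<subseteq> B" "card P = m - 1 - c m"
    by (meson add_leD1 obtain_subset_with_card_n)
  have finB: "finite B" and B: "B \<subseteq> {1..<m}" "A \<inter> B = {}"
    by (auto simp: B_def)
  have finP: "finite P"
    using P finB finite_subset by blast
  have BP: "card (B - P) \<ge> m - 1 - c (m + 1)"
    using P le' by (simp add: card_Diff_subset finP)
  \<comment> \<open>Each vertex of \<open>P\<close> sends its edge to \<open>m\<close> and keeps the
    one from \<open>m + 1\<close>; on \<open>B - P\<close> the roles are swapped. One kept edge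
    suffices there, since \<open>c\<close> is positive on \<open>B\<close>.\<close>
  define h where "h = (\<lambda>(i, j). if i = 0 then j else if i \<in> A then i
      else if (i \<in> P) = (j = m) then j else i)"
  have fin: "finite (edges ?G)"
    by (simp add: complete_bipartite_def)
  have in_ge: "card S \<le> indegree ?G h v" if "S \<subseteq> {e \<in> edges ?G. h e = v}" for S v
    unfolding indegree_def using that fin by (intro card_mono) auto
  have "orientation ?G h"
    by (auto simp: orientation_def complete_bipartite_def h_def)
  moreover have "compatible ?G 0 h c"
    unfolding compatible_def nonsink_verts_complete_bipartite_2[OF m]
  proof
    fix v assume "v \<in> {1..<m} \<union> {m, m + 1}"
    then consider "v \<in> A" | "v \<in> P" | "v \<in> B - P" | "v = m" | "v = m + 1"
      by (auto simp: B_def)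
    then show "int (vdegree ?G v) - int (c v) \<le> int (indegree ?G h v)"
    proof cases
      case 1
      have "card {(v, m), (v, m + 1)} \<le> indegree ?G h v"
        using 1 by (intro in_ge) (auto simp: A_def h_def complete_bipartite_def)
      then show ?thesis
        using 1 by (simp add: A_def vdegree_complete_bipartite)
    next
      case 2
      have "card {(v, m + 1)} \<le> indegree ?G h v"
        using 2 P B by (intro in_ge) (auto simp: h_def complete_bipartite_def)
      then show ?thesis
        using 2 P B_def A_def by (auto simp: vdegree_complete_bipartite)
    next
      case 3
      have "card {(v, m)} \<le> indegree ?G h v"
        using 3 B by (intro in_ge) (auto simp: h_def complete_bipartite_def)
      then show ?thesis
        using 3 B_def A_def by (auto simp: vdegree_complete_bipartite)
    next
      case 4
      \<comment> \<open>The edge from the sink supplies the one unit by which \<open>m - c m\<close>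
        exceeds \<open>card P\<close>.\<close>
      have "card (insert 0 P \<times> {m}) \<le> indegree ?G h v"
        using 4 P B m by (intro in_ge) (fastforce simp: h_def complete_bipartite_def)
      moreover have "0 \<notin> P"
        using P B by auto
      ultimately show ?thesis
        using 4 P finP by (simp add: vdegree_complete_bipartite card_cartesian_product)
    next
      case 5
      have "card (insert 0 (B - P) \<times> {m + 1}) \<le> indegree ?G h v"
        using 5 B m by (intro in_ge) (auto simp: h_def complete_bipartite_def)
      moreover have "0 \<notin> B - P"
        using B by auto
      ultimately show ?thesis
        using 5 BP finB by (simp add: vdegree_complete_bipartite card_cartesian_product)
    qed
  qed
  ultimately show ?thesis
    by blast
qed

text \<open>Eliminates orientations, leaving a pure counting problem. With \<open>2 * m\<close>
  edges and \<open>m + 2\<close> vertices the edge count gives the bound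
  \<open>m - 1\<close>.\<close>

lemma Sto_complete_bipartite_2:
  assumes m: "m \<ge> 1"
  shows "Sto (complete_bipartite m 2) 0 =
    {c \<in> configurations (complete_bipartite m 2) 0. stable (complete_bipartite m 2) 0 c \<and>
       lacking (complete_bipartite m 2) 0 c \<le> m - 1}"
proof -
  let ?G = "complete_bipartite m 2"
  have "lacking ?G 0 c \<le> m - 1" if "compatible ?G 0 h c" "stable ?G 0 c" for h c
    using lacking_le_if_compatible[OF _ _ _ that] m by (simp add: complete_bipartite_def)
  then show ?thesis
    using ex_compatible_complete_bipartite_2[OF m] by (auto simp: Sto_def)
qed

text \<open>Yields the inner sum of \<open>S(m - 1, k)\<close>: the number of admissible sets of
  empty vertices for a fixed \<open>q\<close>.\<close>

lemma card_subsets_card_le: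
  assumes "finite S"
  shows "card {A. A \<subseteq> S \<and> card A \<le> q} = (\<Sum>r = 0..q. card S choose r)"
proof -
  have "{A. A \<subseteq> S \<and> card A \<le> q} = (\<Union>r\<in>{0..q}. {A. A \<subseteq> S \<and> card A = r})"
    by auto
  also have "card \<dots> = (\<Sum>r = 0..q. card {A. A \<subseteq> S \<and> card A = r})"
    using assms by (intro card_UN_disjoint) auto
  finally show ?thesis
    by (simp add: n_subsets assms)
qed

lemma card_Sto_lacking_eq:
  assumes m: "m \<ge> 1" and k: "k \<le> m - 1"
  shows "card {c \<in> Sto (complete_bipartite m 2) 0. lacking (complete_bipartite m 2) 0 c = k} =
    (\<Sum>q = 0..k. \<Sum>r = 0..q. (m - 1) choose r)"
proof -
  let ?G = "complete_bipartite m 2"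
  let ?T = "SIGMA q:{0..k}. {A. A \<subseteq> {1..<m} \<and> card A \<le> q}"
  define empt where "empt c = {i \<in> {1..<m}. c i = 0}" for c :: "nat \<Rightarrow> nat"
  \<comment> \<open>Once the total \<open>k\<close> is fixed, the value at \<open>m + 1\<close> need
    not be recorded: that vertex lacks \<open>k - q\<close> grains.\<close>
  define enc where "enc c = (card (empt c) + (m - 1 - c m), empt c)" for c
  \<comment> \<open>The value \<open>undefined\<close> off the non-sink vertices makes the result
    extensional.\<close>
  define dec where "dec = (\<lambda>(q, A) v. if v \<in> {1..<m} then (if v \<in> A then 0 else 1)
      else if v = m then m - 1 - (q - card A)
      else if v = m + 1 then m - 1 - (k - q) else (undefined :: nat))"
  have stable_iff: "stable ?G 0 c \<longleftrightarrow> (\<forall>i\<in>{1..<m}. c i < 2) \<and> c m < m \<and> c (m + 1) < m" for c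
    unfolding stable_def nonsink_verts_complete_bipartite_2[OF m]
    by (auto simp: vdegree_complete_bipartite)
  have S: "{c \<in> Sto ?G 0. lacking ?G 0 c = k} =
      {c \<in> {1..<m} \<union> {m, m + 1} \<rightarrow>\<^sub>E UNIV. stable ?G 0 c \<and>
        card (empt c) + (m - 1 - c m) + (m - 1 - c (m + 1)) = k}" (is "?S = ?S'")
    using k unfolding Sto_complete_bipartite_2[OF m] configurations_def empt_def
      nonsink_verts_complete_bipartite_2[OF m]
    by (auto simp: lacking_complete_bipartite_2[OF m])
  have "bij_betw enc ?S' ?T"
  proof (rule bij_betw_byWitness[where f' = dec])
    show "\<forall>c\<in>?S'. dec (enc c) = c"
    proof
      fix c assume c: "c \<in> ?S'"
      then have ext: "c \<in> extensional ({1..<m} \<union> {m, m + 1})"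
        and st: "\<And>i. i \<in> {1..<m} \<Longrightarrow> c i < 2" "c m < m" "c (m + 1) < m"
        and eq: "card (empt c) + (m - 1 - c m) + (m - 1 - c (m + 1)) = k"
        by (auto simp: stable_iff PiE_def)
      show "dec (enc c) = c"
      proof
        fix v
        consider "v \<in> {1..<m}" | "v = m" | "v = m + 1" | "v \<notin> {1..<m} \<union> {m, m + 1}"
          by blast
        then show "dec (enc c) v = c v"
        proof cases
          case 1
          then show ?thesis
            using st(1)[OF 1] by (auto simp: dec_def enc_def empt_def)
        next
          case 4
          then show ?thesis
            using ext by (auto simp: dec_def enc_def extensional_def)
        qed (use st(2,3) eq in \<open>auto simp: dec_def enc_def\<close>)
      qed
    qed
    have empt_dec: "empt (dec (q, A)) = A" if "A \<subseteq> {1..<m}" for q A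
      using that by (auto simp: empt_def dec_def)
    have dec_at: "dec (q, A) m = m - 1 - (q - card A)" "dec (q, A) (m + 1) = m - 1 - (k - q)"
      for q A by (auto simp: dec_def)
    \<comment> \<open>As \<open>card A \<le> q \<le> k \<le> m - 1\<close>, no subtraction in
      \<open>dec\<close> truncates, so \<open>q\<close> is recovered.\<close>
    show "\<forall>a\<in>?T. enc (dec a) = a"
      using k by (auto simp: enc_def empt_dec dec_at)
    show "enc ` ?S' \<subseteq> ?T"
      by (auto simp: enc_def empt_def)
    show "dec ` ?T \<subseteq> ?S'"
    proof (rule image_subsetI)
      fix a assume "a \<in> ?T"
      then obtain q A where a: "a = (q, A)" and qA: "q \<in> {0..k}" "A \<subseteq> {1..<m}" "card A \<le> q"
        by blast
      have "dec (q, A) \<in> {1..<m} \<union> {m, m + 1} \<rightarrow>\<^sub>E UNIV"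
        by (auto simp: dec_def split: if_splits)
      moreover have "dec (q, A) i < 2" if "i \<in> {1..<m}" for i
        using that by (simp add: dec_def)
      ultimately show "dec a \<in> ?S'"
        using qA k m unfolding a mem_Collect_eq stable_iff dec_at empt_dec[OF qA(2)]
        by auto
    qed
  qed
  then have "card ?S = card ?T"
    unfolding S by (rule bij_betw_same_card)
  then show ?thesis
    by (simp add: card_subsets_card_le)
qed

theorem theorem8:
  fixes m :: nat
  assumes "m \<ge> 1"
  shows "lacking_poly (complete_bipartite m 2) 0 =
    (\<Sum>k = 0..m - 1. monom (\<Sum>q = 0..k. \<Sum>r = 0..q. int ((m - 1) choose r)) k)"
proof -
  let ?G = "complete_bipartite m 2"
  have fin: "finite (Sto ?G 0)"
    by (rule finite_Sto) (simp add: complete_bipartite_def)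
  \<comment> \<open>The range \<open>0..m - 1\<close> misses no configuration, by the
    characterization of \<open>Sto\<close>.\<close>
  have "lacking_poly ?G 0 =
      (\<Sum>k = 0..m - 1. \<Sum>c\<in>{c \<in> Sto ?G 0. lacking ?G 0 c = k}. monom 1 (lacking ?G 0 c))"
    unfolding lacking_poly_def using fin
    by (intro sum.group[symmetric]) (auto simp: Sto_complete_bipartite_2[OF assms])
  also have "\<dots> = (\<Sum>k = 0..m - 1. monom (\<Sum>q = 0..k. \<Sum>r = 0..q. int ((m - 1) choose r)) k)"
  proof (rule sum.cong[OF refl])
    fix k assume "k \<in> {0..m - 1}"
    then have "int (card {c \<in> Sto ?G 0. lacking ?G 0 c = k}) =
        (\<Sum>q = 0..k. \<Sum>r = 0..q. int ((m - 1) choose r))"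
      by (simp add: card_Sto_lacking_eq[OF assms])
    moreover have "(\<Sum>c\<in>{c \<in> Sto ?G 0. lacking ?G 0 c = k}. monom (1::int) (lacking ?G 0 c)) =
        monom (int (card {c \<in> Sto ?G 0. lacking ?G 0 c = k})) k"
      by (simp add: of_nat_monom mult_monom)
    ultimately show "(\<Sum>c\<in>{c \<in> Sto ?G 0. lacking ?G 0 c = k}. monom 1 (lacking ?G 0 c)) =
        monom (\<Sum>q = 0..k. \<Sum>r = 0..q. int ((m - 1) choose r)) k"
      by simp
  qed
  finally show ?thesis .
qed

end
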